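(* The negative type of $(\mathrm{Dgm}_\infty,w_\infty)$, the space of persistence diagrams with the bottleneck distance, is $0$.
   Context: Let $\mathbb{R}^2_< = \{(x,y)\in\mathbb{R}^2 : x<y\}$ with metric $d_\infty(a,b)=\|a-b\|_\infty=\max(|a_x-b_x|,|a_y-b_y|)$, and let $\Delta$ be the diagonal in $\mathbb{R}^2$; for $a\in\mathbb{R}^2_<$, $d_\infty(a,\Delta)=\inf_{t\in\Delta}\|a-t\|_\infty=(a_y-a_x)/2$. A persistence diagram is a function $D:I\to\mathbb{R}^2_<$ with $I$ a countable (possibly finite or empty) set; $\emptyset$ denotes the diagram with empty index set. A partial matching between $D_1:I_1\to\mathbb{R}^2_<$ and $D_2:I_2\to\mathbb{R}^2_<$ is a triple $(I_1',I_2',f)$ with $I_1'\subseteq I_1$, $I_2'\subseteq I_2$ and $f:I_1'\to I_2'$ a bijection. Its $\infty$-cost is $$\mathrm{cost}_\infty(f)=\max\Big\{\sup_{i\in I_1'}d_\infty(D_1(i),D_2(f(i))),\ \sup_{i\in I_1\setminus I_1'}d_\infty(D_1(i),\Delta),\ \sup_{i\in I_2\setminus I_2'}d_\infty(D_2(i),\Delta)\Big\}\in[0,\infty]$$ (suprema over empty sets are $0$). Put $\tilde w_\infty(D_1,D_2)=\inf\{\mathrm{cost}_\infty(f)\}$ over all partial matchings between $D_1$ and $D_2$. The space $(\mathrm{Dgm}_\infty,w_\infty)$ is the set of persistence diagrams $D$ with $\tilde w_\infty(D,\emptyset)<\infty$, modulo the relation $D_1\sim D_2$ iff $\tilde w_\infty(D_1,D_2)=0$,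 with the induced metric $w_\infty$ (the bottleneck distance). Let $q\ge0$. A metric space (or, more generally, semi-metric space) $(X,d)$ is of $q$-negative type if for any $n\in\mathbb{N}$, $x_1,\dots,x_n\in X$ and $a_1,\dots,a_n\in\mathbb{R}$ with $\sum_{i=1}^n a_i=0$ one has $\sum_{i,j=1}^n a_ia_j\,d(x_i,x_j)^q\le0$. The negative type of $(X,d)$ is the supremum of the set of $q\in[0,\infty)$ such that $(X,d)$ is of $q$-negative type. *)

theory Defs
  imports "HOL-Analysis.Analysis"
begin

definition half_plane :: "(real \<times> real) set" where
  "half_plane = {(x, y). x < y}"

definition diagonal :: "(real \<times> real) set" where
  "diagonal = {(x, y). x = y}"

text \<open>The library metric on \<^typ>\<open>real \<times> real\<close> is Euclidean, so the sup metric is introduced here.\<close>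

definition d_inf :: "real \<times> real \<Rightarrow> real \<times> real \<Rightarrow> real" where
  "d_inf a b = max \<bar>fst a - fst b\<bar> \<bar>snd a - snd b\<bar>"

definition d_inf_diagonal :: "real \<times> real \<Rightarrow> real" where
  "d_inf_diagonal a = (INF t\<in>diagonal. d_inf a t)"

text \<open>
  A diagram \<open>D : I \<rightarrow> half_plane\<close> is a partial map whose domain is the index set \<open>I\<close>. Index sets are
  subsets of \<^typ>\<open>nat\<close>: every countable set is in bijection with such a set, and reindexing a
  diagram along a bijection does not change its class in the quotient below.
\<close>

type_synonym diagram = "nat \<rightharpoonup> real \<times> real"

definition persistence_diagram :: "diagram \<Rightarrow> bool" where
  "persistence_diagram D \<longleftrightarrow> ran D \<subseteq> half_plane"

definition partial_matching ::
    "diagram \<Rightarrow> diagram \<Rightarrow> nat set \<Rightarrow> nat set \<Rightarrow> (nat \<Rightarrow> nat) \<Rightarrow> bool" where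
  "partial_matching D1 D2 J1 J2 f \<longleftrightarrow> J1 \<subseteq> dom D1 \<and> J2 \<subseteq> dom D2 \<and> bij_betw f J1 J2"

text \<open>In \<^typ>\<open>ennreal\<close> the supremum of the empty set is \<open>0\<close>.\<close>

definition cost_inf ::
    "diagram \<Rightarrow> diagram \<Rightarrow> nat set \<Rightarrow> nat set \<Rightarrow> (nat \<Rightarrow> nat) \<Rightarrow> ennreal" where
  "cost_inf D1 D2 J1 J2 f =
     Max {SUP i\<in>J1. ennreal (d_inf (the (D1 i)) (the (D2 (f i)))),
          SUP i\<in>dom D1 - J1. ennreal (d_inf_diagonal (the (D1 i))),
          SUP i\<in>dom D2 - J2. ennreal (d_inf_diagonal (the (D2 i)))}"

definition w_inf_pre :: "diagram \<Rightarrow> diagram \<Rightarrow> ennreal" where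
  "w_inf_pre D1 D2 = Inf {cost_inf D1 D2 J1 J2 f |J1 J2 f. partial_matching D1 D2 J1 J2 f}"

definition finite_diagrams :: "diagram set" where
  "finite_diagrams = {D. persistence_diagram D \<and> w_inf_pre D Map.empty < \<infinity>}"

definition dgm_rel :: "(diagram \<times> diagram) set" where
  "dgm_rel = {(D1, D2). D1 \<in> finite_diagrams \<and> D2 \<in> finite_diagrams \<and> w_inf_pre D1 D2 = 0}"

definition Dgm_inf :: "diagram set set" where
  "Dgm_inf = finite_diagrams // dgm_rel"

text \<open>
  The common finite value of \<^const>\<open>w_inf_pre\<close> on all pairs of representatives; see
  \<open>w_inf_class\<close> below.
\<close>

definition w_inf :: "diagram set \<Rightarrow> diagram set \<Rightarrow> real" where
  "w_inf X Y = enn2real (the_elem ((\<lambda>(D1, D2). w_inf_pre D1 D2) ` (X \<times> Y)))"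

text \<open>
  Here \<open>0 powr q = 0\<close>, also for \<open>q = 0\<close>. Every space is of \<open>0\<close>-negative type both with this
  convention and with \<open>0\<^sup>0 = 1\<close>, so the choice does not affect the supremum.
\<close>

definition q_negative_type :: "'a set \<Rightarrow> ('a \<Rightarrow> 'a \<Rightarrow> real) \<Rightarrow> real \<Rightarrow> bool" where
  "q_negative_type X d q \<longleftrightarrow>
     (\<forall>(n::nat) (x :: nat \<Rightarrow> 'a) (a :: nat \<Rightarrow> real).
        (\<forall>i\<in>{1..n}. x i \<in> X) \<and> (\<Sum>i=1..n. a i) = 0 \<longrightarrow>
        (\<Sum>i=1..n. \<Sum>j=1..n. a i * a j * d (x i) (x j) powr q) \<le> 0)"

definition negative_type :: "'a set \<Rightarrow> ('a \<Rightarrow> 'a \<Rightarrow> real) \<Rightarrow> ereal" where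
  "negative_type X d = Sup (ereal ` {q. 0 \<le> q \<and> q_negative_type X d q})"


subsection \<open>The bottleneck distance is a metric on the quotient\<close>

lemma d_inf_diagonal_eq: "d_inf_diagonal a = \<bar>snd a - fst a\<bar> / 2"
proof -
  define m where "m = (fst a + snd a) / 2"
  have "d_inf a (m, m) = \<bar>snd a - fst a\<bar> / 2"
    by (simp add: d_inf_def m_def field_simps max_def abs_if)
  moreover have "(m, m) \<in> diagonal" by (simp add: diagonal_def)
  moreover have "\<bar>snd a - fst a\<bar> / 2 \<le> d_inf a t" if "t \<in> diagonal" for t
    using that by (auto simp: diagonal_def d_inf_def max_def abs_if)
  ultimately show ?thesis unfolding d_inf_diagonal_def
    by (intro cInf_eq_minimum) (auto simp: image_iff intro: bexI[of _ "(m, m)"])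
qed

lemma d_inf_nonneg [simp]: "0 \<le> d_inf a b"
  by (auto simp: d_inf_def)

lemma d_inf_self [simp]: "d_inf a a = 0"
  by (simp add: d_inf_def)

lemma d_inf_commute: "d_inf a b = d_inf b a"
  by (simp add: d_inf_def abs_minus_commute)

lemma d_inf_triangle: "d_inf a c \<le> d_inf a b + d_inf b c"
  by (auto simp: d_inf_def)

lemma d_inf_diagonal_nonneg [simp]: "0 \<le> d_inf_diagonal a"
  by (simp add: d_inf_diagonal_eq)

lemma d_inf_diagonal_triangle: "d_inf_diagonal a \<le> d_inf a b + d_inf_diagonal b"
  unfolding d_inf_def d_inf_diagonal_eq by (simp add: max_def abs_if)

lemma cost_inf_le_iff:
  "cost_inf D1 D2 J1 J2 f \<le> c \<longleftrightarrow>
     (\<forall>i\<in>J1. ennreal (d_inf (the (D1 i)) (the (D2 (f i)))) \<le> c) \<and>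
     (\<forall>i\<in>dom D1 - J1. ennreal (d_inf_diagonal (the (D1 i))) \<le> c) \<and>
     (\<forall>i\<in>dom D2 - J2. ennreal (d_inf_diagonal (the (D2 i))) \<le> c)"
  unfolding cost_inf_def by (simp add: SUP_le_iff)

lemma w_inf_pre_le:
  "partial_matching D1 D2 J1 J2 f \<Longrightarrow> cost_inf D1 D2 J1 J2 f \<le> c \<Longrightarrow> w_inf_pre D1 D2 \<le> c"
  unfolding w_inf_pre_def by (rule Inf_lower2) auto

lemma w_inf_pre_self [simp]: "w_inf_pre D D = 0"
proof -
  have "w_inf_pre D D \<le> 0"
    by (rule w_inf_pre_le[of D D "dom D" "dom D" id])
       (simp_all add: partial_matching_def cost_inf_le_iff del: le_zero_eq)
  then show ?thesis by (simp only: le_zero_eq)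
qed

lemma w_inf_pre_commute_le: "w_inf_pre D2 D1 \<le> w_inf_pre D1 D2"
  unfolding w_inf_pre_def[of D1 D2]
proof (rule Inf_greatest, clarify)
  fix J1 J2 f
  assume m: "partial_matching D1 D2 J1 J2 f"
  let ?g = "the_inv_into J1 f"
  have inj: "inj_on f J1" and im: "f ` J1 = J2"
    using m by (auto simp: partial_matching_def bij_betw_def)
  have "partial_matching D2 D1 J2 J1 ?g"
    using m by (auto simp: partial_matching_def bij_betw_the_inv_into)
  moreover have "cost_inf D2 D1 J2 J1 ?g \<le> cost_inf D1 D2 J1 J2 f"
    using cost_inf_le_iff[of D1 D2 J1 J2 f "cost_inf D1 D2 J1 J2 f"] im
    by (auto simp: cost_inf_le_iff the_inv_into_f_f[OF inj] d_inf_commute)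
  ultimately show "w_inf_pre D2 D1 \<le> cost_inf D1 D2 J1 J2 f"
    by (rule w_inf_pre_le)
qed

lemma w_inf_pre_commute: "w_inf_pre D1 D2 = w_inf_pre D2 D1"
  by (intro antisym w_inf_pre_commute_le)

lemma w_inf_pre_triangle_cost:
  assumes f: "partial_matching D1 D2 A1 A2 f" and g: "partial_matching D2 D3 B2 B3 g"
  shows "w_inf_pre D1 D3 \<le> cost_inf D1 D2 A1 A2 f + cost_inf D2 D3 B2 B3 g"
    (is "_ \<le> ?c + ?d")
proof -
  let ?C = "{i \<in> A1. f i \<in> B2}" and ?h = "\<lambda>i. g (f i)"
  have F: "inj_on f A1" "f ` A1 = A2" "A1 \<subseteq> dom D1" "A2 \<subseteq> dom D2"
    and G: "inj_on g B2" "g ` B2 = B3" "B2 \<subseteq> dom D2" "B3 \<subseteq> dom D3"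
    using f g by (auto simp: partial_matching_def bij_betw_def)
  have c: "ennreal (d_inf (the (D1 i)) (the (D2 (f i)))) \<le> ?c" if "i \<in> A1" for i
    using cost_inf_le_iff[of D1 D2 A1 A2 f ?c] that by blast
  have c1: "ennreal (d_inf_diagonal (the (D1 i))) \<le> ?c" if "i \<in> dom D1 - A1" for i
    using cost_inf_le_iff[of D1 D2 A1 A2 f ?c] that by blast
  have c2: "ennreal (d_inf_diagonal (the (D2 i))) \<le> ?c" if "i \<in> dom D2 - A2" for i
    using cost_inf_le_iff[of D1 D2 A1 A2 f ?c] that by blast
  have d: "ennreal (d_inf (the (D2 i)) (the (D3 (g i)))) \<le> ?d" if "i \<in> B2" for i
    using cost_inf_le_iff[of D2 D3 B2 B3 g ?d] that by blast
  have d2: "ennreal (d_inf_diagonal (the (D2 i))) \<le> ?d" if "i \<in> dom D2 - B2" for i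
    using cost_inf_le_iff[of D2 D3 B2 B3 g ?d] that by blast
  have d3: "ennreal (d_inf_diagonal (the (D3 i))) \<le> ?d" if "i \<in> dom D3 - B3" for i
    using cost_inf_le_iff[of D2 D3 B2 B3 g ?d] that by blast
  have add: "ennreal z \<le> u + v"
    if "z \<le> x + y" "ennreal x \<le> u" "ennreal y \<le> v" "0 \<le> x" "0 \<le> y" for x y z u v
  proof -
    have "ennreal z \<le> ennreal (x + y)" using that by (intro ennreal_leI)
    also have "\<dots> = ennreal x + ennreal y" using that by (simp add: ennreal_plus)
    also have "\<dots> \<le> u + v" using that by (intro add_mono)
    finally show ?thesis .
  qed
  have "partial_matching D1 D3 ?C (?h ` ?C) ?h"
    using F G by (auto simp: partial_matching_def bij_betw_def inj_on_def)
  moreover have "cost_inf D1 D3 ?C (?h ` ?C) ?h \<le> ?c + ?d"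
    unfolding cost_inf_le_iff
  proof (intro conjI ballI)
    fix i assume "i \<in> ?C"
    then show "ennreal (d_inf (the (D1 i)) (the (D3 (?h i)))) \<le> ?c + ?d"
      using add[OF d_inf_triangle c d] by simp
  next
    fix i assume i: "i \<in> dom D1 - ?C"
    show "ennreal (d_inf_diagonal (the (D1 i))) \<le> ?c + ?d"
    proof (cases "i \<in> A1")
      case True
      then have "f i \<in> dom D2 - B2" using i F by auto
      then show ?thesis using add[OF d_inf_diagonal_triangle c[OF True] d2] by simp
    next
      case False
      then show ?thesis using c1[of i] i by (auto intro: order_trans add_increasing2)
    qed
  next
    fix k assume k: "k \<in> dom D3 - ?h ` ?C"
    show "ennreal (d_inf_diagonal (the (D3 k))) \<le> ?c + ?d"
    proof (cases "k \<in> B3")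
      case True
      then obtain j where j: "j \<in> B2" "k = g j" using G by auto
      then have j': "j \<in> dom D2 - A2" using k F G by auto
      have "d_inf_diagonal (the (D3 k)) \<le>
          d_inf_diagonal (the (D2 j)) + d_inf (the (D2 j)) (the (D3 k))"
        using d_inf_diagonal_triangle[of "the (D3 k)" "the (D2 j)"]
        by (simp add: d_inf_commute add.commute)
      then show ?thesis using add[OF _ c2[OF j'] d[OF j(1)]] j by simp
    next
      case False
      then show ?thesis using d3[of k] k by (auto intro: order_trans add_increasing)
    qed
  qed
  ultimately show ?thesis by (rule w_inf_pre_le)
qed

lemma w_inf_pre_triangle: "w_inf_pre D1 D3 \<le> w_inf_pre D1 D2 + w_inf_pre D2 D3"
proof (rule ennreal_le_epsilon)
  fix e :: real
  assume fin: "w_inf_pre D1 D2 + w_inf_pre D2 D3 < top" and e: "0 < e"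
  have less: "w_inf_pre D E < w_inf_pre D E + ennreal (e / 2)"
    if "w_inf_pre D E < top" for D E
    using that e by (cases "w_inf_pre D E") (auto simp flip: ennreal_plus simp: ennreal_less_iff)
  have "\<exists>A1 A2 f. partial_matching D E A1 A2 f \<and>
      cost_inf D E A1 A2 f < w_inf_pre D E + ennreal (e / 2)"
    if "w_inf_pre D E < top" for D E
    using less[OF that] unfolding w_inf_pre_def[of D E] Inf_less_iff by blast
  then obtain A1 A2 f B2 B3 g where
    f: "partial_matching D1 D2 A1 A2 f" "cost_inf D1 D2 A1 A2 f < w_inf_pre D1 D2 + ennreal (e / 2)"
    and g: "partial_matching D2 D3 B2 B3 g" "cost_inf D2 D3 B2 B3 g < w_inf_pre D2 D3 + ennreal (e / 2)"
    using fin by (metis ennreal_add_less_top)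
  have "w_inf_pre D1 D3 \<le>
      (w_inf_pre D1 D2 + ennreal (e / 2)) + (w_inf_pre D2 D3 + ennreal (e / 2))"
    using w_inf_pre_triangle_cost[OF f(1) g(1)] add_mono[OF less_imp_le[OF f(2)] less_imp_le[OF g(2)]]
    by (rule order_trans)
  also have "\<dots> = w_inf_pre D1 D2 + w_inf_pre D2 D3 + (ennreal (e / 2) + ennreal (e / 2))"
    by (simp add: ac_simps)
  also have "ennreal (e / 2) + ennreal (e / 2) = ennreal e"
    using e by (simp flip: ennreal_plus)
  finally show "w_inf_pre D1 D3 \<le> w_inf_pre D1 D2 + w_inf_pre D2 D3 + ennreal e" .
qed

lemma w_inf_pre_finite:
  assumes "D1 \<in> finite_diagrams" "D2 \<in> finite_diagrams"
  shows "w_inf_pre D1 D2 < \<infinity>"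
proof -
  have "w_inf_pre D1 D2 \<le> w_inf_pre D1 Map.empty + w_inf_pre D2 Map.empty"
    using w_inf_pre_triangle w_inf_pre_commute by metis
  also have "\<dots> < \<infinity>"
    using assms by (simp add: finite_diagrams_def)
  finally show ?thesis .
qed

lemma equiv_dgm_rel: "equiv finite_diagrams dgm_rel"
proof (rule equivI)
  show "refl_on finite_diagrams dgm_rel"
    by (auto simp: refl_on_def dgm_rel_def)
  show "sym dgm_rel"
    by (auto simp: sym_def dgm_rel_def w_inf_pre_commute)
  show "trans dgm_rel"
  proof (rule transI)
    fix D E F assume "(D, E) \<in> dgm_rel" "(E, F) \<in> dgm_rel"
    then show "(D, F) \<in> dgm_rel"
      using w_inf_pre_triangle[of D F E] by (simp add: dgm_rel_def)
  qed
qed (auto simp: dgm_rel_def)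

lemma w_inf_pre_cong:
  assumes "(D, D') \<in> dgm_rel" "(E, E') \<in> dgm_rel"
  shows "w_inf_pre D E = w_inf_pre D' E'"
proof -
  have le: "w_inf_pre F G \<le> w_inf_pre F' G'"
    if "w_inf_pre F F' = 0" "w_inf_pre G G' = 0" for F F' G G'
  proof -
    have "w_inf_pre F G \<le> w_inf_pre F F' + (w_inf_pre F' G' + w_inf_pre G' G)"
      using w_inf_pre_triangle[of F G F'] w_inf_pre_triangle[of F' G G']
      by (meson add_left_mono order_trans)
    then show ?thesis using that by (simp add: w_inf_pre_commute)
  qed
  show ?thesis
    using assms by (intro antisym le) (auto simp: dgm_rel_def w_inf_pre_commute)
qed

lemma w_inf_class:
  assumes "D \<in> finite_diagrams" "E \<in> finite_diagrams"
  shows "w_inf (dgm_rel `` {D}) (dgm_rel `` {E}) = enn2real (w_inf_pre D E)"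
proof -
  have self: "D \<in> dgm_rel `` {D}" "E \<in> dgm_rel `` {E}"
    using assms by (auto simp: dgm_rel_def)
  have eq: "w_inf_pre D' E' = w_inf_pre D E" if "D' \<in> dgm_rel `` {D}" "E' \<in> dgm_rel `` {E}" for D' E'
    using that w_inf_pre_cong[of D D' E E'] by simp
  have "(\<lambda>(D1, D2). w_inf_pre D1 D2) ` (dgm_rel `` {D} \<times> dgm_rel `` {E})
      = {w_inf_pre D E}"
  proof (intro equalityI subsetI)
    fix r assume "r \<in> {w_inf_pre D E}"
    then show "r \<in> (\<lambda>(D1, D2). w_inf_pre D1 D2) ` (dgm_rel `` {D} \<times> dgm_rel `` {E})"
      using self by (intro image_eqI[of _ _ "(D, E)"]) simp_all
  qed (auto intro: eq)
  then show ?thesis by (simp add: w_inf_def)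
qed

lemma Metric_space_Dgm_inf: "Metric_space Dgm_inf w_inf"
proof
  have commute: "w_inf X Y = w_inf Y X" for X Y
  proof -
    have "(\<lambda>(D1, D2). w_inf_pre D1 D2) ` (X \<times> Y)
        = (\<lambda>(D1, D2). w_inf_pre D1 D2) ` (Y \<times> X)"
      using w_inf_pre_commute by force
    then show ?thesis by (simp add: w_inf_def)
  qed
  show "0 \<le> w_inf X Y" for X Y
    by (simp add: w_inf_def)
  show "w_inf X Y = w_inf Y X" for X Y by (rule commute)
  show "w_inf X Y = 0 \<longleftrightarrow> X = Y" if XY: "X \<in> Dgm_inf" "Y \<in> Dgm_inf" for X Y
  proof -
    obtain D E where D: "D \<in> finite_diagrams" "X = dgm_rel `` {D}"
      and E: "E \<in> finite_diagrams" "Y = dgm_rel `` {E}"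
      using XY unfolding Dgm_inf_def by (auto elim!: quotientE)
    have "w_inf X Y = 0 \<longleftrightarrow> w_inf_pre D E = 0"
      using w_inf_pre_finite[OF D(1) E(1)] by (auto simp: D E w_inf_class enn2real_eq_0_iff)
    also have "\<dots> \<longleftrightarrow> (D, E) \<in> dgm_rel" using D E by (simp add: dgm_rel_def)
    also have "\<dots> \<longleftrightarrow> X = Y" using eq_equiv_class_iff[OF equiv_dgm_rel] D E by auto
    finally show ?thesis .
  qed
  show "w_inf X Z \<le> w_inf X Y + w_inf Y Z"
    if XYZ: "X \<in> Dgm_inf" "Y \<in> Dgm_inf" "Z \<in> Dgm_inf" for X Y Z
  proof -
    obtain D E F where D: "D \<in> finite_diagrams" "X = dgm_rel `` {D}"
      and E: "E \<in> finite_diagrams" "Y = dgm_rel `` {E}"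
      and F: "F \<in> finite_diagrams" "Z = dgm_rel `` {F}"
      using XYZ unfolding Dgm_inf_def by (auto elim!: quotientE)
    have "enn2real (w_inf_pre D F) \<le> enn2real (w_inf_pre D E + w_inf_pre E F)"
      using w_inf_pre_finite D E F by (intro enn2real_mono w_inf_pre_triangle) auto
    also have "\<dots> = enn2real (w_inf_pre D E) + enn2real (w_inf_pre E F)"
      using w_inf_pre_finite D E F by (intro enn2real_plus) auto
    finally show ?thesis using D E F by (simp add: w_inf_class)
  qed
qed

end

theory Submission
  imports Defs
begin

text \<open>
  The complete bipartite graph \<open>K\<^bsub>m,m\<^esub>\<close> with its path metric (distance \<open>2\<close> inside a part, \<open>1\<close> across)
  with weights \<open>1\<close> and \<open>-1\<close> on the two parts has energy \<open>2 m ((m - 1) 2\<^sup>q - m)\<close>, which is positive for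
  every \<open>q > 0\<close> once \<open>m\<close> is large. All these graphs embed isometrically into the space of diagrams, by
  the embedding into \<open>\<ell>\<^sub>\<infinity>\<close> that lets one off-diagonal point per coordinate move vertically. These
  points are so far from each other and from the diagonal that only the identity matching is optimal.
\<close>

text \<open>As \<open>0 powr 0 = 0\<close>, the kernel is 1 minus the indicator of
  \<open>x i = x j\<close>. Points may repeat; grouping indices by the point they hit turns the
  energy into the squared total weight, which is 0, minus a sum of squares.\<close>

lemma (in Metric_space) q_negative_type_0: "q_negative_type M d 0"
  unfolding q_negative_type_def
proof (intro allI impI, elim conjE)
  fix n and x :: "nat \<Rightarrow> 'a" and a :: "nat \<Rightarrow> real"
  assume x: "\<forall>i\<in>{1..n}. x i \<in> M" and a: "(\<Sum>i=1..n. a i) = 0"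
  let ?ind = "\<lambda>i y. of_bool (x i = y) :: real"
  have "(\<Sum>i=1..n. \<Sum>j=1..n. a i * a j * d (x i) (x j) powr 0) =
      (\<Sum>i=1..n. \<Sum>j=1..n. a i * a j - (\<Sum>y\<in>x ` {1..n}. (a i * ?ind i y) * (a j * ?ind j y)))"
  proof (intro sum.cong refl)
    fix i j assume ij: "i \<in> {1..n}" "j \<in> {1..n}"
    have "(\<Sum>y\<in>x ` {1..n}. (a i * ?ind i y) * (a j * ?ind j y)) =
        (\<Sum>y\<in>x ` {1..n}. if y = x i then a i * a j * of_bool (x i = x j) else 0)"
      by (intro sum.cong) auto
    also have "\<dots> = a i * a j * of_bool (x i = x j)"
      using ij by (subst sum.delta) auto
    finally show "a i * a j * d (x i) (x j) powr 0 =
        a i * a j - (\<Sum>y\<in>x ` {1..n}. (a i * ?ind i y) * (a j * ?ind j y))"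
      using ij x by simp
  qed
  also have "\<dots> = (\<Sum>i=1..n. a i)\<^sup>2 - (\<Sum>y\<in>x ` {1..n}. (\<Sum>i=1..n. a i * ?ind i y)\<^sup>2)"
  proof -
    have "(\<Sum>i=1..n. \<Sum>j=1..n. \<Sum>y\<in>x ` {1..n}. (a i * ?ind i y) * (a j * ?ind j y)) =
        (\<Sum>i=1..n. \<Sum>y\<in>x ` {1..n}. \<Sum>j=1..n. (a i * ?ind i y) * (a j * ?ind j y))"
      by (intro sum.cong refl sum.swap)
    also have "\<dots> = (\<Sum>y\<in>x ` {1..n}. \<Sum>i=1..n. \<Sum>j=1..n. (a i * ?ind i y) * (a j * ?ind j y))"
      by (rule sum.swap)
    finally show ?thesis
      by (simp only: sum_subtractf power2_eq_square sum_product)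
  qed
  also have "\<dots> \<le> 0"
    by (simp only: a) (simp add: sum_nonneg)
  finally show "(\<Sum>i=1..n. \<Sum>j=1..n. a i * a j * d (x i) (x j) powr 0) \<le> 0" .
qed

lemma sum_alternating_eq_0: "(\<Sum>i=1..2 * m. (-1) ^ i :: real) = 0"
  by (induction m) simp_all

text \<open>Parity classes are the parts. Weight products are 1 inside a part and -1 across, so
  larger distances inside and smaller ones across only raise the energy.\<close>

lemma not_q_negative_type_bipartite:
  fixes y :: "nat \<Rightarrow> 'a"
  assumes y: "\<And>i. y i \<in> X" and nonneg: "\<And>i j. 0 \<le> d (y i) (y j)"
    and same: "\<And>i j. i \<noteq> j \<Longrightarrow> even (i + j) \<Longrightarrow> 2 \<le> d (y i) (y j)"
    and across: "\<And>i j. odd (i + j) \<Longrightarrow> d (y i) (y j) \<le> 1"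
    and q: "0 < q"
  shows "\<not> q_negative_type X d q"
proof
  assume neg: "q_negative_type X d q"
  define t :: real where "t = 2 powr q"
  have t: "1 < t" using q by (simp add: t_def)
  \<comment> \<open>This makes \<open>m * (t - 1) - t\<close>, the factor deciding the sign of the
    energy, positive.\<close>
  obtain m :: nat where m: "t / (t - 1) < m"
    using reals_Archimedean2 by blast
  let ?n = "2 * m" and ?a = "\<lambda>i. (-1) ^ i :: real"
  have m0: "0 < m" and mt: "t < m * (t - 1)"
    using m t by (auto simp: field_simps intro!: gr0I)
  \<comment> \<open>The left side is the summand for the graph itself: \<open>t\<close> for distinct
    vertices of one part, 0 for \<open>i = j\<close>, -1 across. It is affine in
    \<open>?a i * ?a j\<close>, whose double sum vanishes.\<close>
  have "(t - 1) / 2 + (t + 1) / 2 * (?a i * ?a j) - (if i = j then t else 0)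
      \<le> ?a i * ?a j * d (y i) (y j) powr q" for i j
  proof (cases "even (i + j)")
    case True
    then have "?a i * ?a j = 1" by (simp flip: power_add)
    moreover have "t \<le> d (y i) (y j) powr q" if "i \<noteq> j"
      unfolding t_def using same[OF that True] q by (intro powr_mono2) auto
    ultimately show ?thesis by (auto simp: field_simps)
  next
    case False
    then have "?a i * ?a j = -1" by (simp flip: power_add)
    moreover have "d (y i) (y j) powr q \<le> 1 powr q"
      using across[OF False] nonneg q by (intro powr_mono2) auto
    ultimately show ?thesis using False by (auto simp: field_simps)
  qed
  then have "(\<Sum>i=1..?n. \<Sum>j=1..?n. (t - 1) / 2 + (t + 1) / 2 * (?a i * ?a j) - (if i = j then t else 0))
      \<le> (\<Sum>i=1..?n. \<Sum>j=1..?n. ?a i * ?a j * d (y i) (y j) powr q)"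
    by (intro sum_mono)
  also have "\<dots> \<le> 0"
    using neg y sum_alternating_eq_0 unfolding q_negative_type_def by blast
  also have "(\<Sum>i=1..?n. \<Sum>j=1..?n. (t - 1) / 2 + (t + 1) / 2 * (?a i * ?a j) - (if i = j then t else 0))
      = 2 * m * (m * (t - 1) - t)"
  proof -
    have "(\<Sum>i=1..?n. \<Sum>j=1..?n. (t + 1) / 2 * (?a i * ?a j)) = 0"
      by (simp only: sum_alternating_eq_0 mult_zero_right flip: sum_distrib_left)
         simp
    then show ?thesis
      by (simp only: sum.distrib sum_subtractf) (simp add: field_simps)
  qed
  finally show False
    using m0 mt by (simp add: mult_le_0_iff)
qed

text \<open>This is 2 minus the path distance in the complete bipartite graph on even and odd
  numbers: a reflected Kuratowski embedding.\<close>

definition vertex_coord :: "nat \<Rightarrow> nat \<Rightarrow> real" where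
  "vertex_coord u k = (if odd (u + k) then 1 else if u = k then 2 else 0)"

text \<open>First coordinates 4 apart make pairing different indices cost at least 4; persistence at
  least 4 makes an unmatched point cost at least 2, the diameter of the graph.\<close>

definition vertex_diagram :: "nat \<Rightarrow> diagram" where
  "vertex_diagram u k = Some (4 * real k, 4 * real k + 4 + vertex_coord u k)"

lemma dom_vertex_diagram [simp]: "dom (vertex_diagram u) = UNIV"
  by (auto simp: vertex_diagram_def)

lemma vertex_coord_bounds: "0 \<le> vertex_coord u k" "vertex_coord u k \<le> 2"
  by (auto simp: vertex_coord_def)

lemma vertex_diagram_finite: "vertex_diagram u \<in> finite_diagrams"
proof -
  have "persistence_diagram (vertex_diagram u)"
    using vertex_coord_bounds(1)[of u]
    by (fastforce simp: persistence_diagram_def half_plane_def vertex_diagram_def ran_def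
        intro: add_pos_nonneg)
  \<comment> \<open>The bound 3 is half the largest possible persistence, 4 + 2.\<close>
  moreover have "w_inf_pre (vertex_diagram u) Map.empty \<le> ennreal 3"
    using vertex_coord_bounds[of u]
    by (intro w_inf_pre_le[of _ _ "{}" "{}" id])
       (auto simp: partial_matching_def cost_inf_le_iff d_inf_diagonal_eq vertex_diagram_def
         intro!: ennreal_leI simp del: ennreal_numeral)
  ultimately show ?thesis
    by (auto simp: finite_diagrams_def intro: le_less_trans)
qed

text \<open>For each \<open>k\<close> exactly one of \<open>u + k\<close> and \<open>v + k\<close>
  is odd, so one coordinate is 1 and the other 0 or 2.\<close>

lemma w_inf_pre_vertex_across:
  assumes "odd (u + v)"
  shows "w_inf_pre (vertex_diagram u) (vertex_diagram v) \<le> ennreal 1"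
  using assms
  by (intro w_inf_pre_le[of _ _ UNIV UNIV id])
     (auto simp: partial_matching_def cost_inf_le_iff d_inf_def vertex_diagram_def
       vertex_coord_def intro!: ennreal_leI simp del: ennreal_1)

text \<open>The point with index \<open>u\<close> alone forces the cost: its coordinate is 2 in the
  first diagram and 0 in the second.\<close>

lemma w_inf_pre_vertex_same:
  assumes "even (u + v)" "u \<noteq> v"
  shows "ennreal 2 \<le> w_inf_pre (vertex_diagram u) (vertex_diagram v)"
  unfolding w_inf_pre_def
proof (rule Inf_greatest, clarify)
  fix J1 J2 f
  let ?D = "vertex_diagram u" and ?E = "vertex_diagram v"
  let ?c = "cost_inf ?D ?E J1 J2 f"
  have c: "\<forall>i\<in>J1. ennreal (d_inf (the (?D i)) (the (?E (f i)))) \<le> ?c"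
      "\<forall>i\<in>UNIV - J1. ennreal (d_inf_diagonal (the (?D i))) \<le> ?c"
    using cost_inf_le_iff[of ?D ?E J1 J2 f ?c] by auto
  show "ennreal 2 \<le> ?c"
  proof (cases "u \<in> J1")
    case True
    have "2 \<le> d_inf (the (?D u)) (the (?E (f u)))"
    proof (cases "f u = u")
      case True
      then show ?thesis using assms by (simp add: d_inf_def vertex_diagram_def vertex_coord_def)
    next
      case False
      then have "1 \<le> \<bar>real u - real (f u)\<bar>" by linarith
      then show ?thesis by (simp add: d_inf_def vertex_diagram_def)
    qed
    then show ?thesis using c(1) True by (meson ennreal_leI order_trans)
  next
    case False
    have "2 \<le> d_inf_diagonal (the (?D u))"
      using vertex_coord_bounds by (simp add: d_inf_diagonal_eq vertex_diagram_def)
    then show ?thesis using c(2) False by (meson DiffI UNIV_I ennreal_leI order_trans)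
  qed
qed

lemma not_q_negative_type_Dgm_inf:
  assumes "0 < q"
  shows "\<not> q_negative_type Dgm_inf w_inf q"
proof (rule not_q_negative_type_bipartite[where y = "\<lambda>u. dgm_rel `` {vertex_diagram u}"])
  note fin = vertex_diagram_finite
  show "dgm_rel `` {vertex_diagram i} \<in> Dgm_inf" for i
    using fin by (auto simp: Dgm_inf_def intro: quotientI)
  show "0 \<le> w_inf (dgm_rel `` {vertex_diagram i}) (dgm_rel `` {vertex_diagram j})" for i j
    by (simp add: w_inf_def)
  show "2 \<le> w_inf (dgm_rel `` {vertex_diagram i}) (dgm_rel `` {vertex_diagram j})"
    if "i \<noteq> j" "even (i + j)" for i j
    \<comment> \<open>Finiteness matters for this lower bound, as \<open>enn2real\<close> sends
      infinity to 0.\<close>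
    using enn2real_mono[OF w_inf_pre_vertex_same[OF that(2,1)]] w_inf_pre_finite[OF fin fin]
    by (simp add: w_inf_class fin)
  show "w_inf (dgm_rel `` {vertex_diagram i}) (dgm_rel `` {vertex_diagram j}) \<le> 1"
    if "odd (i + j)" for i j
    using enn2real_mono[OF w_inf_pre_vertex_across[OF that]] by (simp add: w_inf_class fin)
qed (fact assms)

theorem mainTheorem6: "negative_type Dgm_inf w_inf = 0"
proof -
  \<comment> \<open>Membership of 0 keeps the supremum in \<open>ereal\<close> from being that of
    the empty set, minus infinity.\<close>
  have "{q. 0 \<le> q \<and> q_negative_type Dgm_inf w_inf q} = {0}"
    using not_q_negative_type_Dgm_inf Metric_space.q_negative_type_0[OF Metric_space_Dgm_inf]
    by (auto simp: order_le_less)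
  then show ?thesis by (simp add: negative_type_def zero_ereal_def)
qed

end
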